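(* Let $(X_n)_{n\ge 0}$ be a sequence of i.i.d. real-valued random variables with mean $\mu=E(X_0)$ and variance $\sigma^2=\mathrm{Var}(X_0)$ satisfying $0<\sigma^2<\infty$. Let $F(x)=P(\hat X_0\le x)$ be the distribution function of $\hat X_0=\sigma^{-1}(X_0-\mu)$. For $a\in[0,1)$ let $S_a=\sum_{n=0}^\infty a^nX_n$, let $$\hat S_a=\frac{S_a-E(S_a)}{\sqrt{\mathrm{Var}(S_a)}}=\frac{\sqrt{1-a^2}}{\sigma}\left(S_a-\frac{\mu}{1-a}\right),$$ and let $F_a(x)=P(\hat S_a\le x)$. Let $\Phi(x)=\frac{1}{\sqrt{2\pi}}\int_{-\infty}^x e^{-u^2/2}\,du$ be the standard normal distribution function. Assume $F\in\mathcal{P}^s$ for some $s\in(2,3]$. Then, for every $a\in(0,1)$, $$d_2(F_a,\Phi)\le\left[\frac{(s-2)(1-a^2)}{e\cdot a^2}\right]^{\frac12(s-2)}\cdot d_s(F,\Phi).$$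
   Context: The series defining $S_a$ converges almost surely. For real $s>0$, $\mathcal{P}^s$ denotes the set of all probability distribution functions $G$ on $\mathbb{R}$ such that $\int_{-\infty}^\infty|x|^s\,dG(x)<\infty$, $\int_{-\infty}^\infty x\,dG(x)=0$ and $\int_{-\infty}^\infty x^2\,dG(x)=1$. For a probability distribution function $G$ on $\mathbb{R}$, its characteristic function is $C_G(\xi)=\int_{-\infty}^\infty e^{-i\xi x}\,dG(x)$. For real $s>0$ and probability distribution functions $G,H$ on $\mathbb{R}$, the Fourier distance of type $s$ is $$d_s(G,H)=\sup_{\xi\neq 0}\frac{|C_G(\xi)-C_H(\xi)|}{|\xi|^s},$$ which is finite when $s\in[2,3]$ and $G,H\in\mathcal{P}^s$. Here $e$ is the base of the natural logarithm. *)

theory Defs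
  imports "HOL-Probability.Probability"
begin

definition is_distribution_function :: "(real \<Rightarrow> real) \<Rightarrow> bool" where
  "is_distribution_function G \<longleftrightarrow>
     mono G \<and> (\<forall>x. continuous (at_right x) G) \<and>
     (G \<longlongrightarrow> 0) at_bot \<and> (G \<longlongrightarrow> 1) at_top"

text \<open>
  Integrals \<open>\<integral> f(x) dG(x)\<close> are Lebesgue--Stieltjes integrals, that is, Lebesgue integrals with
  respect to \<^const>\<open>interval_measure\<close> of \<open>G\<close>. In the class below, the requirement that the second
  moment be \<open>1 \<noteq> 0\<close> already forces \<open>x\<^sup>2\<close>, and hence \<open>x\<close>, to be integrable, so that the
  convention that non-integrable functions have integral \<open>0\<close> plays no role.
\<close>

definition moment_class :: "real \<Rightarrow> (real \<Rightarrow> real) set" where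
  "moment_class s = {G. is_distribution_function G \<and>
     integrable (interval_measure G) (\<lambda>x. \<bar>x\<bar> powr s) \<and>
     (LINT x|interval_measure G. x) = 0 \<and>
     (LINT x|interval_measure G. x\<^sup>2) = 1}"

text \<open>
  The convention here is \<open>C\<^sub>G(\<xi>) = \<integral> exp(-i\<xi>x) dG(x)\<close>, whereas \<^const>\<open>char\<close> uses \<open>exp(i\<xi>x)\<close>.
\<close>

definition char_fun :: "(real \<Rightarrow> real) \<Rightarrow> real \<Rightarrow> complex" where
  "char_fun G \<xi> = char (interval_measure G) (- \<xi>)"

text \<open>
  The supremum is taken in the extended nonnegative reals, so no boundedness side condition is
  hidden in it.
\<close>

definition fourier_dist :: "real \<Rightarrow> (real \<Rightarrow> real) \<Rightarrow> (real \<Rightarrow> real) \<Rightarrow> ennreal" where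
  "fourier_dist s G H =
     (SUP \<xi>\<in>{\<xi>. \<xi> \<noteq> 0}. ennreal (cmod (char_fun G \<xi> - char_fun H \<xi>) / \<bar>\<xi>\<bar> powr s))"

text \<open>
  Where the series diverges (a null set in the case of interest), \<^const>\<open>suminf\<close> has a fixed
  unspecified value.
\<close>

definition power_sum :: "real \<Rightarrow> (nat \<Rightarrow> 'a \<Rightarrow> real) \<Rightarrow> 'a \<Rightarrow> real" where
  "power_sum a X \<omega> = (\<Sum>n. a ^ n * X n \<omega>)"

definition standardize :: "'a measure \<Rightarrow> ('a \<Rightarrow> real) \<Rightarrow> 'a \<Rightarrow> real" where
  "standardize M Y \<omega> =
     (Y \<omega> - prob_space.expectation M Y) / sqrt (prob_space.variance M Y)"

end

theory Submission
  imports Defs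
begin

text \<open>
  Write \<open>b\<^sup>2 = 1 - a\<^sup>2\<close>, let \<open>\<phi>\<close> and \<open>\<psi>\<close> be the characteristic functions of \<open>F\<close> and \<open>F\<^sub>a\<close>, and let
  \<open>g(\<xi>) = exp(-\<xi>\<^sup>2/2)\<close>. Both \<open>\<psi>\<close> and \<open>g\<close> are self-decomposable: \<open>\<psi>(\<xi>) = \<phi>(b\<xi>) \<psi>(a\<xi>)\<close> and
  \<open>g(\<xi>) = g(b\<xi>) g(a\<xi>)\<close>. Hence the error \<open>E = |\<psi> - g|\<close> satisfies
  \<open>E(\<xi>) \<le> E(a\<xi>) + g(a\<xi>) d\<^sub>s |b\<xi>|\<^sup>s\<close>. Maximising \<open>t\<^sup>p exp(-t\<^sup>2/2)\<close> over \<open>t = a|\<xi>|\<close> for \<open>p = s - 2\<close> bounds the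
  last term by \<open>K b\<^sup>2 \<xi>\<^sup>2 = K \<xi>\<^sup>2 - K (a\<xi>)\<^sup>2\<close> with \<open>K\<close> the claimed bound. So \<open>E(\<xi>) - K \<xi>\<^sup>2\<close> does not
  decrease when \<open>\<xi>\<close> is replaced by \<open>a\<xi>\<close>, and its limit along \<open>a\<^sup>n\<xi>\<close> is \<open>0\<close>.
\<close>

section \<open>Distribution functions and the measures they determine\<close>

text \<open>A probability measure on the line is determined by its distribution function, and both
  sides have the same one. This turns \<open>char_fun\<close> of a \<open>cdf\<close> into the
  characteristic function of the underlying law.\<close>

lemma interval_measure_cdf:
  assumes "real_distribution N"
  shows "interval_measure (cdf N) = N"
proof -
  interpret real_distribution N by fact
  have mono: "cdf N x \<le> cdf N y" if "x \<le> y" for x y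
    using that by (rule cdf_nondecreasing)
  have cont: "continuous (at_right x) (cdf N)" for x
    by (rule cdf_is_right_cont)
  have bot: "(cdf N \<longlongrightarrow> 0) at_bot" and top: "(cdf N \<longlongrightarrow> 1) at_top"
    by (rule cdf_lim_at_bot, rule cdf_lim_at_top_prob)
  have "real_distribution (interval_measure (cdf N))"
    using mono cont bot top by (rule real_distribution_interval_measure)
  moreover have "cdf (interval_measure (cdf N)) = cdf N"
    unfolding cdf_def[of "interval_measure (cdf N)"]
    using measure_interval_measure_Iic[OF mono cont bot] by auto
  ultimately show ?thesis
    using assms by (intro cdf_unique)
qed

lemma char_fun_cdf: "real_distribution N \<Longrightarrow> char_fun (cdf N) \<xi> = char N (- \<xi>)"
  by (simp add: char_fun_def interval_measure_cdf)

section \<open>Moments and characteristic function of a random geometric series\<close>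

text \<open>By Tonelli the integral of the sum of the norms is the sum of their integrals, hence
  finite, so the sum itself is finite almost everywhere. This is the pointwise condition under which
  series and integral may be exchanged.\<close>

lemma AE_summable_norm:
  fixes f :: "nat \<Rightarrow> 'a \<Rightarrow> 'b::{banach, second_countable_topology}"
  assumes f: "\<And>n. integrable M (f n)" and sum: "summable (\<lambda>n. \<integral>x. norm (f n x) \<partial>M)"
  shows "AE x in M. summable (\<lambda>n. norm (f n x))"
proof -
  have [measurable]: "f n \<in> borel_measurable M" for n
    using f by auto
  have "(\<integral>\<^sup>+x. (\<Sum>n. ennreal (norm (f n x))) \<partial>M) = (\<Sum>n. \<integral>\<^sup>+x. norm (f n x) \<partial>M)"
    by (rule nn_integral_suminf) measurable
  also have "\<dots> = (\<Sum>n. ennreal (\<integral>x. norm (f n x) \<partial>M))"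
    using f by (simp add: nn_integral_eq_integral)
  also have "\<dots> \<noteq> \<infinity>"
    using sum by (simp add: ennreal_suminf_neq_top)
  finally have "AE x in M. (\<Sum>n. ennreal (norm (f n x))) \<noteq> \<infinity>"
    by (intro nn_integral_PInf_AE) auto
  then show ?thesis
    by eventually_elim (auto intro: summable_suminf_not_top)
qed

text \<open>Induction on \<open>N\<close>: the new term is independent of the partial sum, so the
  cross product is integrable and its expectation is a product of two means, one of which is
  0.\<close>

lemma (in prob_space) expectation_square_sum_indep:
  fixes Y :: "nat \<Rightarrow> 'a \<Rightarrow> real"
  assumes indep: "indep_vars (\<lambda>_. borel) Y UNIV"
    and sq: "\<And>n. integrable M (\<lambda>\<omega>. (Y n \<omega>)\<^sup>2)" and mean: "\<And>n. expectation (Y n) = 0"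
  shows "integrable M (\<lambda>\<omega>. (\<Sum>n<N. Y n \<omega>)\<^sup>2)"
    and "expectation (\<lambda>\<omega>. (\<Sum>n<N. Y n \<omega>)\<^sup>2) = (\<Sum>n<N. expectation (\<lambda>\<omega>. (Y n \<omega>)\<^sup>2))"
proof -
  have [measurable]: "Y n \<in> borel_measurable M" for n
    using indep unfolding indep_vars_def2 by simp
  have int: "integrable M (Y n)" for n
    by (rule square_integrable_imp_integrable[OF _ sq]) auto
  have "integrable M (\<lambda>\<omega>. (\<Sum>n<N. Y n \<omega>)\<^sup>2) \<and>
    expectation (\<lambda>\<omega>. (\<Sum>n<N. Y n \<omega>)\<^sup>2) = (\<Sum>n<N. expectation (\<lambda>\<omega>. (Y n \<omega>)\<^sup>2))"
  proof (induction N)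
    case (Suc N)
    let ?S = "\<lambda>\<omega>. \<Sum>n<N. Y n \<omega>"
    have ind: "indep_var borel (Y N) borel ?S"
      by (rule indep_vars_sum[OF _ _ indep_vars_subset[OF indep]]) auto
    have intS: "integrable M ?S"
      using int by auto
    have "integrable M (\<lambda>\<omega>. Y N \<omega> * ?S \<omega>)" "expectation (\<lambda>\<omega>. Y N \<omega> * ?S \<omega>) = 0"
      using indep_var_integrable[OF ind int intS] indep_var_lebesgue_integral[OF ind int intS] mean
      by auto
    moreover have "(\<Sum>n<Suc N. Y n \<omega>)\<^sup>2 = (?S \<omega>)\<^sup>2 + 2 * (Y N \<omega> * ?S \<omega>) + (Y N \<omega>)\<^sup>2" for \<omega>
      by (simp add: power2_eq_square algebra_simps)
    ultimately show ?case
      using Suc sq by simp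
  qed simp
  then show "integrable M (\<lambda>\<omega>. (\<Sum>n<N. Y n \<omega>)\<^sup>2)"
    and "expectation (\<lambda>\<omega>. (\<Sum>n<N. Y n \<omega>)\<^sup>2) = (\<Sum>n<N. expectation (\<lambda>\<omega>. (Y n \<omega>)\<^sup>2))"
    by auto
qed

lemma borel_measurable_power_sum [measurable (raw)]:
  "(\<And>n. Z n \<in> borel_measurable M) \<Longrightarrow> power_sum a Z \<in> borel_measurable M"
  unfolding power_sum_def[abs_def] by measurable

text \<open>Convergence and the mean follow from summability of the first absolute moments. The
  second moment is the limit of those of the partial sums, by dominated convergence.\<close>

lemma (in prob_space) power_sum_moments:
  fixes Z :: "nat \<Rightarrow> 'a \<Rightarrow> real"
  assumes indep: "indep_vars (\<lambda>_. borel) Z UNIV"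
    and sq: "\<And>n. integrable M (\<lambda>\<omega>. (Z n \<omega>)\<^sup>2)"
    and mean: "\<And>n. expectation (Z n) = 0" and var: "\<And>n. expectation (\<lambda>\<omega>. (Z n \<omega>)\<^sup>2) = 1"
    and a: "0 < a" "a < 1"
  shows "AE \<omega> in M. summable (\<lambda>n. a ^ n * Z n \<omega>)"
    and "integrable M (power_sum a Z)"
    and "expectation (power_sum a Z) = 0"
    and "expectation (\<lambda>\<omega>. (power_sum a Z \<omega>)\<^sup>2) = 1 / (1 - a\<^sup>2)"
proof -
  have [measurable]: "Z n \<in> borel_measurable M" for n
    using indep unfolding indep_vars_def2 by simp
  have int: "integrable M (Z n)" for n
    by (rule square_integrable_imp_integrable[OF _ sq]) auto
  have abs_le: "expectation (\<lambda>\<omega>. \<bar>Z n \<omega>\<bar>) \<le> 1" for n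
  proof -
    have "expectation (\<lambda>\<omega>. \<bar>Z n \<omega>\<bar>) \<le> expectation (\<lambda>\<omega>. (1 + (Z n \<omega>)\<^sup>2) / 2)"
    proof (rule integral_mono)
      show "\<bar>Z n \<omega>\<bar> \<le> (1 + (Z n \<omega>)\<^sup>2) / 2" for \<omega>
        using zero_le_power2[of "1 - \<bar>Z n \<omega>\<bar>"] by (simp add: power2_diff)
    qed (use int sq in auto)
    also have "\<dots> = 1"
      using sq var by (simp add: prob_space)
    finally show ?thesis .
  qed
  have geo: "summable (\<lambda>n. a ^ n)"
    using a by (intro summable_geometric) auto
  have sum1: "summable (\<lambda>n. \<integral>\<omega>. norm (a ^ n * Z n \<omega>) \<partial>M)"
    using abs_le a by (intro summable_comparison_test'[OF geo]) (auto simp: abs_mult mult_left_le)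
  have int1: "integrable M (\<lambda>\<omega>. a ^ n * Z n \<omega>)" for n
    using int by auto
  note AE1 = AE_summable_norm[OF int1 sum1]
  then show conv: "AE \<omega> in M. summable (\<lambda>n. a ^ n * Z n \<omega>)"
    by eventually_elim (rule summable_norm_cancel)
  show "integrable M (power_sum a Z)"
    unfolding power_sum_def[abs_def] by (rule integrable_suminf[OF int1 AE1 sum1])
  show "expectation (power_sum a Z) = 0"
    unfolding power_sum_def[abs_def] using mean by (subst integral_suminf[OF int1 AE1 sum1]) simp

  have int2: "integrable M (\<lambda>\<omega>. a ^ n * (Z n \<omega>)\<^sup>2)" for n
    using sq by auto
  have sum2: "summable (\<lambda>n. \<integral>\<omega>. norm (a ^ n * (Z n \<omega>)\<^sup>2) \<partial>M)"
    using geo a var by (simp add: abs_mult)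
  note AE2 = AE_summable_norm[OF int2 sum2]
  \<comment> \<open>An integrable majorant for all squared partial sums. It comes from
    Cauchy-Schwarz after splitting \<open>a ^ n\<close> evenly between the two factors through
    \<open>sqrt (a ^ n)\<close>; the constant \<open>1 / (1 - a)\<close> is the sum of the
    \<open>a ^ n\<close>.\<close>
  define W where "W \<omega> = (1 / (1 - a)) * (\<Sum>n. a ^ n * (Z n \<omega>)\<^sup>2)" for \<omega>
  have W: "integrable M W"
    unfolding W_def[abs_def] by (intro integrable_mult_right integrable_suminf[OF int2 AE2 sum2])
  let ?S = "\<lambda>N \<omega>. \<Sum>n<N. a ^ n * Z n \<omega>"
  have dom: "AE \<omega> in M. norm ((?S N \<omega>)\<^sup>2) \<le> W \<omega>" for N
    using AE2
  proof eventually_elim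
    case (elim \<omega>)
    have "(?S N \<omega>)\<^sup>2 = (\<Sum>n<N. sqrt (a ^ n) * (sqrt (a ^ n) * Z n \<omega>))\<^sup>2"
      using a by (simp add: mult.assoc[symmetric])
    also have "\<dots> \<le> (\<Sum>n<N. (sqrt (a ^ n))\<^sup>2) * (\<Sum>n<N. (sqrt (a ^ n) * Z n \<omega>)\<^sup>2)"
      by (rule Cauchy_Schwarz_ineq_sum)
    also have "\<dots> = (\<Sum>n<N. a ^ n) * (\<Sum>n<N. a ^ n * (Z n \<omega>)\<^sup>2)"
      using a by (simp add: power_mult_distrib)
    also have "\<dots> \<le> (\<Sum>n. a ^ n) * (\<Sum>n. a ^ n * (Z n \<omega>)\<^sup>2)"
      using a elim geo
      by (intro mult_mono sum_le_suminf sum_nonneg suminf_nonneg) (auto dest: summable_norm_cancel)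
    also have "\<dots> = W \<omega>"
      using a by (simp add: W_def suminf_geometric)
    finally show ?case by simp
  qed
  have lim: "AE \<omega> in M. (\<lambda>N. (?S N \<omega>)\<^sup>2) \<longlonglongrightarrow> (power_sum a Z \<omega>)\<^sup>2"
    unfolding power_sum_def using conv
    by eventually_elim (intro tendsto_power summable_LIMSEQ)
  have "(\<lambda>N. expectation (\<lambda>\<omega>. (?S N \<omega>)\<^sup>2)) \<longlonglongrightarrow> expectation (\<lambda>\<omega>. (power_sum a Z \<omega>)\<^sup>2)"
    by (rule integral_dominated_convergence[OF _ _ W lim dom]) measurable
  moreover have "expectation (\<lambda>\<omega>. (?S N \<omega>)\<^sup>2) = (\<Sum>n<N. (a\<^sup>2) ^ n)" for N
  proof -
    have "indep_vars (\<lambda>_. borel) (\<lambda>n \<omega>. a ^ n * Z n \<omega>) UNIV"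
      by (rule indep_vars_compose2[OF indep]) auto
    then show ?thesis
      using mean var sq
      by (subst expectation_square_sum_indep)
        (auto simp: power_mult_distrib power_mult[symmetric] mult.commute)
  qed
  moreover have "(\<lambda>N. \<Sum>n<N. (a\<^sup>2) ^ n) \<longlonglongrightarrow> 1 / (1 - a\<^sup>2)"
    using geometric_sums[of "a\<^sup>2"] a by (simp add: sums_def power_less_one_iff)
  ultimately show "expectation (\<lambda>\<omega>. (power_sum a Z \<omega>)\<^sup>2) = 1 / (1 - a\<^sup>2)"
    by (auto intro: LIMSEQ_unique)
qed

text \<open>By independence and almost sure convergence, the characteristic function at
  \<open>t\<close> is the infinite product of the \<open>char N (a ^ n * t)\<close>. Splitting off
  the factor for n = 0 leaves the same product at \<open>a * t\<close>.\<close>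

lemma (in prob_space) char_distr_power_sum:
  fixes Z :: "nat \<Rightarrow> 'a \<Rightarrow> real"
  assumes indep: "indep_vars (\<lambda>_. borel) Z UNIV"
    and ident: "\<And>n. distr M borel (Z n) = N"
    and conv: "AE \<omega> in M. summable (\<lambda>n. a ^ n * Z n \<omega>)"
  shows "char (distr M borel (power_sum a Z)) \<xi>
    = char N \<xi> * char (distr M borel (power_sum a Z)) (a * \<xi>)"
proof -
  have [measurable]: "Z n \<in> borel_measurable M" for n
    using indep unfolding indep_vars_def2 by simp
  let ?C = "char (distr M borel (power_sum a Z))"
  let ?S = "\<lambda>k \<omega>. \<Sum>n<k. a ^ n * Z n \<omega>"
  have lim: "(\<lambda>k. \<Prod>n<k. char N (a ^ n * t)) \<longlonglongrightarrow> ?C t" for t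
  proof -
    have "char (distr M borel (?S k)) t = (\<Prod>n<k. char N (a ^ n * t))" for k
    proof -
      have "indep_vars (\<lambda>_. borel) (\<lambda>n \<omega>. a ^ n * Z n \<omega>) {..<k}"
        by (rule indep_vars_compose2[OF indep_vars_subset[OF indep]]) auto
      moreover have "char (distr M borel (\<lambda>\<omega>. a ^ n * Z n \<omega>)) t = char N (a ^ n * t)" for n
        unfolding ident[of n, symmetric] by (simp add: char_def integral_distr ac_simps)
      ultimately show ?thesis
        by (simp add: char_distr_sum)
    qed
    moreover have "(\<lambda>k. CLINT \<omega>|M. iexp (t * ?S k \<omega>)) \<longlonglongrightarrow> (CLINT \<omega>|M. iexp (t * power_sum a Z \<omega>))"
    proof (rule integral_dominated_convergence[where w = "\<lambda>_. 1"])
      show "AE \<omega> in M. (\<lambda>k. iexp (t * ?S k \<omega>)) \<longlonglongrightarrow> iexp (t * power_sum a Z \<omega>)"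
        using conv
        unfolding power_sum_def
        by eventually_elim
          (intro isCont_tendsto_compose[OF isCont_iexp] tendsto_mult_left summable_LIMSEQ)
    qed (auto simp del: of_real_mult of_real_sum)
    ultimately show ?thesis
      by (simp add: char_def integral_distr)
  qed
  \<comment> \<open>The product at \<open>a * \<xi>\<close>, multiplied by
    \<open>char N \<xi>\<close>, is the product at \<xi> with one more factor; the index shift does
    not affect the limit.\<close>
  have "(\<lambda>k. char N \<xi> * (\<Prod>n<k. char N (a ^ n * (a * \<xi>)))) \<longlonglongrightarrow> char N \<xi> * ?C (a * \<xi>)"
    by (intro tendsto_mult_left lim)
  moreover have "char N \<xi> * (\<Prod>n<k. char N (a ^ n * (a * \<xi>))) = (\<Prod>n<Suc k. char N (a ^ n * \<xi>))" for k
    by (subst prod.lessThan_Suc_shift) (simp add: ac_simps)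
  ultimately show ?thesis
    using LIMSEQ_Suc[OF lim[of \<xi>]] by (auto intro: LIMSEQ_unique)
qed

section \<open>Analytic estimate for self-decomposable characteristic functions\<close>

text \<open>The maximum over t is attained at \<open>t\<^sup>2 = p\<close>. After taking logarithms
  the claim is \<open>ln u \<le> u - 1\<close> at \<open>u = t\<^sup>2 / p\<close>, with equality
  exactly at that point.\<close>

lemma powr_mult_exp_le:
  fixes t p :: real
  assumes "0 < t" "0 < p"
  shows "t powr p * exp (- t\<^sup>2 / 2) \<le> (p / exp 1) powr (p / 2)"
proof -
  have "ln (t\<^sup>2 / p) \<le> t\<^sup>2 / p - 1"
    using assms by (intro ln_le_minus_one) auto
  then have "2 * ln t - ln p \<le> t\<^sup>2 / p - 1"
    using assms by (simp add: ln_div ln_realpow)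
  then have "p / 2 * (2 * ln t - ln p) \<le> p / 2 * (t\<^sup>2 / p - 1)"
    using assms by (intro mult_left_mono) auto
  also have "p / 2 * (t\<^sup>2 / p - 1) = t\<^sup>2 / 2 - p / 2"
    using assms by (simp add: field_simps)
  finally have "p * ln t - t\<^sup>2 / 2 \<le> p / 2 * (ln p - 1)"
    by (simp add: algebra_simps)
  moreover have "t powr p * exp (- t\<^sup>2 / 2) = exp (p * ln t - t\<^sup>2 / 2)"
    using assms by (simp add: powr_def flip: exp_add)
  moreover have "(p / exp 1) powr (p / 2) = exp (p / 2 * (ln p - 1))"
    using assms by (simp add: powr_def ln_div)
  ultimately show ?thesis
    by simp
qed

text \<open>Of the power s, two are kept as the quadratic factor that will telescope. The remaining
  power p = s - 2 is written in terms of t = a|x|, at the price of the factor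
  \<open>(b / a) powr p\<close>, and is absorbed by the Gaussian.\<close>

lemma gaussian_powr_bound:
  fixes a b s D x :: real
  assumes ab: "0 < a" "0 < b" and s: "2 < s" and "0 \<le> D"
  shows "exp (- (a * x)\<^sup>2 / 2) * (D * \<bar>b * x\<bar> powr s)
    \<le> ((s - 2) * b\<^sup>2 / (exp 1 * a\<^sup>2)) powr ((s - 2) / 2) * D * (b\<^sup>2 * x\<^sup>2)"
proof (cases "x = 0")
  case False
  define p t where "p = s - 2" and "t = a * \<bar>x\<bar>"
  have pos: "0 < p" "0 < t" and tsq: "t\<^sup>2 = (a * x)\<^sup>2" and bt: "\<bar>b * x\<bar> = b / a * t"
    using False ab s by (auto simp: p_def t_def power_mult_distrib abs_mult)
  have "\<bar>b * x\<bar> powr s = \<bar>b * x\<bar> powr 2 * \<bar>b * x\<bar> powr p"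
    unfolding powr_add[symmetric] by (simp add: p_def)
  also have "\<bar>b * x\<bar> powr 2 = b\<^sup>2 * x\<^sup>2"
    using False ab by (simp add: power_mult_distrib)
  also have "\<bar>b * x\<bar> powr p = (b / a) powr p * t powr p"
    unfolding bt by (rule powr_mult)
  finally have "exp (- (a * x)\<^sup>2 / 2) * (D * \<bar>b * x\<bar> powr s)
      = (D * (b\<^sup>2 * x\<^sup>2) * (b / a) powr p) * (t powr p * exp (- t\<^sup>2 / 2))"
    by (simp add: tsq)
  also have "\<dots> \<le> (D * (b\<^sup>2 * x\<^sup>2) * (b / a) powr p) * (p / exp 1) powr (p / 2)"
    using \<open>0 \<le> D\<close> pos by (intro mult_left_mono powr_mult_exp_le) auto
  also have "(b / a) powr p = ((b / a)\<^sup>2) powr (p / 2)"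
    using ab by (simp add: powr_powr flip: powr_numeral)
  also have "(D * (b\<^sup>2 * x\<^sup>2) * ((b / a)\<^sup>2) powr (p / 2)) * (p / exp 1) powr (p / 2)
      = D * (b\<^sup>2 * x\<^sup>2) * ((b / a)\<^sup>2 * (p / exp 1)) powr (p / 2)"
    by (simp only: powr_mult mult.assoc)
  also have "(b / a)\<^sup>2 * (p / exp 1) = (s - 2) * b\<^sup>2 / (exp 1 * a\<^sup>2)"
    by (simp add: p_def power_divide mult_ac)
  finally show ?thesis
    by (simp add: p_def mult_ac)
qed simp

text \<open>The analytic core, stated for abstract \<open>\<phi>\<close> and \<open>\<psi>\<close>:
  a one-step inequality between x and \<open>a * x\<close> is iterated down to 0, where continuity
  of \<open>\<psi>\<close> closes the argument.\<close>

lemma self_decomposable_char_bound: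
  fixes \<phi> \<psi> :: "real \<Rightarrow> complex" and a b s D \<xi> :: real
  assumes ab: "0 < a" "a < 1" "0 < b" "b\<^sup>2 = 1 - a\<^sup>2" and s: "2 < s" and D: "0 \<le> D"
    and decomp: "\<And>x. \<psi> x = \<phi> (b * x) * \<psi> (a * x)"
    and \<psi>: "isCont \<psi> 0" "\<psi> 0 = 1" and \<phi>: "\<And>x. cmod (\<phi> x) \<le> 1"
    and close: "\<And>x. cmod (\<phi> x - exp (- x\<^sup>2 / 2)) \<le> D * \<bar>x\<bar> powr s"
  shows "cmod (\<psi> \<xi> - exp (- \<xi>\<^sup>2 / 2))
    \<le> ((s - 2) * (1 - a\<^sup>2) / (exp 1 * a\<^sup>2)) powr ((s - 2) / 2) * D * \<xi>\<^sup>2"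
proof -
  define g :: "real \<Rightarrow> complex" where "g x = exp (- x\<^sup>2 / 2)" for x
  define K where "K = ((s - 2) * (1 - a\<^sup>2) / (exp 1 * a\<^sup>2)) powr ((s - 2) / 2) * D"
  \<comment> \<open>Since \<open>b\<^sup>2 = 1 - a\<^sup>2\<close>, subtracting
    \<open>K * x\<^sup>2\<close> absorbs the error of each step, so that the recursion becomes plain
    monotonicity.\<close>
  define H where "H x = cmod (\<psi> x - g x) - K * x\<^sup>2" for x
  have g_decomp: "g x = g (b * x) * g (a * x)" for x
  proof -
    have "x\<^sup>2 = (b * x)\<^sup>2 + (a * x)\<^sup>2"
      using ab by (simp add: power_mult_distrib left_diff_distrib)
    then have "- x\<^sup>2 / 2 = - (b * x)\<^sup>2 / 2 + - (a * x)\<^sup>2 / 2"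
      by simp
    then show ?thesis
      unfolding g_def by (simp add: exp_add[symmetric] flip: of_real_mult)
  qed
  have step: "H x \<le> H (a * x)" for x
  proof -
    \<comment> \<open>The mixed term is chosen so that \<open>g (a * x)\<close> multiplies the error
      of \<open>\<phi>\<close>: its Gaussian decay offsets growth of order s. The other factor
      \<open>\<phi> (b * x)\<close> has modulus at most 1, so the error of \<open>\<psi>\<close> is
      passed on without amplification.\<close>
    have "\<psi> x - g x = \<phi> (b * x) * (\<psi> (a * x) - g (a * x)) + g (a * x) * (\<phi> (b * x) - g (b * x))"
      unfolding decomp[of x] g_decomp[of x] by (simp add: algebra_simps)
    then have "cmod (\<psi> x - g x) \<le> cmod (\<phi> (b * x) * (\<psi> (a * x) - g (a * x)))
        + cmod (g (a * x) * (\<phi> (b * x) - g (b * x)))"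
      by (simp add: norm_triangle_ineq)
    also have "\<dots> \<le> cmod (\<psi> (a * x) - g (a * x)) + exp (- (a * x)\<^sup>2 / 2) * (D * \<bar>b * x\<bar> powr s)"
      using \<phi> close[of "b * x"] unfolding norm_mult
      by (intro add_mono mult_mono mult_left_le_one_le) (auto simp: g_def)
    also have "exp (- (a * x)\<^sup>2 / 2) * (D * \<bar>b * x\<bar> powr s) \<le> K * (b\<^sup>2 * x\<^sup>2)"
      using gaussian_powr_bound[of a b s D x] ab s D by (simp add: K_def)
    also have "K * (b\<^sup>2 * x\<^sup>2) = K * x\<^sup>2 - K * (a * x)\<^sup>2"
      unfolding ab(4) by (simp add: power_mult_distrib algebra_simps)
    finally show ?thesis
      by (simp add: H_def)
  qed
  have "H \<xi> \<le> H (a ^ n * \<xi>)" for n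
  proof (induction n)
    case (Suc n)
    with step[of "a ^ n * \<xi>"] show ?case
      by (simp add: mult_ac)
  qed simp
  moreover have "(\<lambda>n. H (a ^ n * \<xi>)) \<longlonglongrightarrow> H 0"
  proof (rule isCont_tendsto_compose[where g = H])
    show "isCont H 0"
      unfolding H_def g_def by (intro continuous_intros \<psi>(1)) auto
    show "(\<lambda>n. a ^ n * \<xi>) \<longlonglongrightarrow> 0"
      using ab by (intro tendsto_mult_left_zero LIMSEQ_power_zero) auto
  qed
  \<comment> \<open>Here \<open>H 0\<close> is 0, because \<open>\<psi>\<close> and \<open>g\<close>
    both equal 1 at 0.\<close>
  ultimately have "H \<xi> \<le> H 0"
    by (intro LIMSEQ_le_const) auto
  then show ?thesis
    by (simp add: H_def \<psi> g_def K_def)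
qed

section \<open>Standardisation and finiteness of the Fourier distance\<close>

text \<open>Standardisation is invariant under increasing affine maps. An almost sure relation
  suffices, since mean and variance ignore null sets; this matters because the series is only known
  to converge almost surely.\<close>

lemma standardize_affine:
  assumes "prob_space M"
    and T: "integrable M T" "prob_space.expectation M T = 0"
    and var: "prob_space.expectation M (\<lambda>\<omega>. (T \<omega>)\<^sup>2) = v"
    and Y: "Y \<in> borel_measurable M" "AE \<omega> in M. Y \<omega> = \<sigma> * T \<omega> + m"
    and "0 < \<sigma>"
  shows "AE \<omega> in M. standardize M Y \<omega> = T \<omega> / sqrt v"
proof -
  interpret prob_space M by fact
  have "expectation Y = expectation (\<lambda>\<omega>. \<sigma> * T \<omega> + m)"
    using Y T by (intro integral_cong_AE) auto
  also have "\<dots> = m"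
    using T by (simp add: prob_space)
  finally have mean: "expectation Y = m" .
  have "variance Y = expectation (\<lambda>\<omega>. \<sigma>\<^sup>2 * (T \<omega>)\<^sup>2)"
  proof (rule integral_cong_AE)
    show "AE \<omega> in M. (Y \<omega> - expectation Y)\<^sup>2 = \<sigma>\<^sup>2 * (T \<omega>)\<^sup>2"
      using Y(2) by eventually_elim (simp add: mean power_mult_distrib)
  qed (use Y T in auto)
  then have "sqrt (variance Y) = \<sigma> * sqrt v"
    using var \<open>0 < \<sigma>\<close> by (simp add: real_sqrt_mult)
  then show ?thesis
    using Y(2) \<open>0 < \<sigma>\<close> by (auto simp: standardize_def mean)
qed

text \<open>Passes from a finite supremum in \<open>ennreal\<close> to a real constant equal to it,
  so that the estimate can be carried out over the reals without loss.\<close>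

lemma fourier_dist_finite_bound:
  assumes "fourier_dist s G H < \<top>"
  obtains D where "0 \<le> D" "fourier_dist s G H = ennreal D"
    "\<And>\<xi>. \<xi> \<noteq> 0 \<Longrightarrow> cmod (char_fun G \<xi> - char_fun H \<xi>) \<le> D * \<bar>\<xi>\<bar> powr s"
proof -
  obtain D where D: "0 \<le> D" "fourier_dist s G H = ennreal D"
    using assms by (cases "fourier_dist s G H") auto
  have "cmod (char_fun G \<xi> - char_fun H \<xi>) \<le> D * \<bar>\<xi>\<bar> powr s" if "\<xi> \<noteq> 0" for \<xi>
  proof -
    have "ennreal (cmod (char_fun G \<xi> - char_fun H \<xi>) / \<bar>\<xi>\<bar> powr s) \<le> ennreal D"
      unfolding D(2)[symmetric] fourier_dist_def using that by (intro SUP_upper) auto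
    with D that show ?thesis
      by (simp add: divide_le_eq)
  qed
  with D that show ?thesis by blast
qed

section \<open>Application to the standardised power sum\<close>

theorem theorem2:
  fixes M :: "'a measure" and X :: "nat \<Rightarrow> 'a \<Rightarrow> real"
    and \<mu> \<sigma> s a :: real and F F\<^sub>a \<Phi> :: "real \<Rightarrow> real"
  assumes "prob_space M"
    and "prob_space.indep_vars M (\<lambda>_. borel) X UNIV"
    and "\<And>n. distr M borel (X n) = distr M borel (X 0)"
    and "integrable M (X 0)"
    and "integrable M (\<lambda>\<omega>. (X 0 \<omega>)\<^sup>2)"
    and "\<mu> = prob_space.expectation M (X 0)"
    and "\<sigma>\<^sup>2 = prob_space.variance M (X 0)"
    and "\<sigma> > 0"
    and "F = cdf (distr M borel (\<lambda>\<omega>. inverse \<sigma> * (X 0 \<omega> - \<mu>)))"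
    and "F\<^sub>a = cdf (distr M borel (standardize M (power_sum a X)))"
    and "\<Phi> = cdf std_normal_distribution"
    and "2 < s" and "s \<le> 3"
    and "F \<in> moment_class s"
    and "0 < a" and "a < 1"
  shows "fourier_dist 2 F\<^sub>a \<Phi>
    \<le> ennreal (((s - 2) * (1 - a\<^sup>2) / (exp 1 * a\<^sup>2)) powr ((s - 2) / 2)) * fourier_dist s F \<Phi>"
proof -
  interpret prob_space M by fact
  note indep = \<open>indep_vars (\<lambda>_. borel) X UNIV\<close> and ident = assms(3) and a = \<open>0 < a\<close> \<open>a < 1\<close>
  have X [measurable]: "X n \<in> borel_measurable M" for n
    using indep unfolding indep_vars_def2 by simp
  \<comment> \<open>The standardised terms: \<open>F\<close> is the distribution function of
    \<open>Z 0\<close>, and all \<open>Z n\<close> share its law \<open>N\<close>, through which the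
    moments of \<open>Z 0\<close> carry over to every \<open>n\<close>.\<close>
  define Z where "Z n \<omega> = inverse \<sigma> * (X n \<omega> - \<mu>)" for n \<omega>
  have Z [measurable]: "Z n \<in> borel_measurable M" for n
    unfolding Z_def by measurable
  define N where "N = distr M borel (Z 0)"
  have ZN: "distr M borel (Z n) = N" for n
  proof -
    have "distr M borel (Z n) = distr (distr M borel (X n)) borel (\<lambda>x. inverse \<sigma> * (x - \<mu>))" for n
      by (subst distr_distr) (auto simp: Z_def[abs_def] comp_def)
    then show ?thesis
      unfolding N_def by (simp only: ident[of n])
  qed
  interpret N: real_distribution N
    unfolding N_def by (rule real_distribution_distr) measurable
  have Z_indep: "indep_vars (\<lambda>_. borel) Z UNIV"
    unfolding Z_def[abs_def] by (rule indep_vars_compose2[OF indep]) measurable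
  have Z0: "integrable M (\<lambda>\<omega>. (Z 0 \<omega>)\<^sup>2)" "expectation (Z 0) = 0" "expectation (\<lambda>\<omega>. (Z 0 \<omega>)\<^sup>2) = 1"
  proof -
    have "integrable M (\<lambda>\<omega>. (X 0 \<omega> - \<mu>)\<^sup>2)"
      using assms(4,5) by (simp add: power2_diff)
    moreover have "expectation (\<lambda>\<omega>. (X 0 \<omega> - \<mu>)\<^sup>2) = \<sigma>\<^sup>2"
      using assms(6,7) by simp
    moreover have "(Z 0 \<omega>)\<^sup>2 = (inverse \<sigma>)\<^sup>2 * (X 0 \<omega> - \<mu>)\<^sup>2" for \<omega>
      by (simp add: Z_def power_mult_distrib)
    ultimately show "integrable M (\<lambda>\<omega>. (Z 0 \<omega>)\<^sup>2)" "expectation (\<lambda>\<omega>. (Z 0 \<omega>)\<^sup>2) = 1"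
      using \<open>\<sigma> > 0\<close> by (simp_all add: power_inverse)
    show "expectation (Z 0) = 0"
      using assms(4,6) by (simp add: Z_def[abs_def] prob_space)
  qed
  have Z_sq: "integrable M (\<lambda>\<omega>. (Z n \<omega>)\<^sup>2)" for n
  proof -
    have "integrable N (\<lambda>x. x\<^sup>2)"
      unfolding N_def using Z0 by (subst integrable_distr_eq) auto
    then show ?thesis
      unfolding ZN[of n, symmetric] by (subst (asm) integrable_distr_eq) auto
  qed
  have Z_mean: "expectation (Z n) = 0" for n
  proof -
    have "expectation (Z n) = (\<integral>x. x \<partial>distr M borel (Z n))"
      by (subst integral_distr) auto
    also have "\<dots> = expectation (Z 0)"
      unfolding ZN unfolding N_def by (subst integral_distr) auto
    finally show ?thesis using Z0 by simp
  qed
  have Z_var: "expectation (\<lambda>\<omega>. (Z n \<omega>)\<^sup>2) = 1" for n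
  proof -
    have "expectation (\<lambda>\<omega>. (Z n \<omega>)\<^sup>2) = (\<integral>x. x\<^sup>2 \<partial>distr M borel (Z n))"
      by (subst integral_distr) auto
    also have "\<dots> = expectation (\<lambda>\<omega>. (Z 0 \<omega>)\<^sup>2)"
      unfolding ZN unfolding N_def by (subst integral_distr) auto
    finally show ?thesis using Z0 by simp
  qed
  note T = power_sum_moments[OF Z_indep Z_sq Z_mean Z_var a]

  define b where "b = sqrt (1 - a\<^sup>2)"
  have a2: "a\<^sup>2 < 1"
    using a by (simp add: power_less_one_iff)
  then have b: "0 < b" "b\<^sup>2 = 1 - a\<^sup>2"
    by (auto simp: b_def)
  \<comment> \<open>On the event of convergence the series splits linearly, and the centring
    contributes \<mu> times a geometric series.\<close>
  have affine: "AE \<omega> in M. power_sum a X \<omega> = \<sigma> * power_sum a Z \<omega> + \<mu> / (1 - a)"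
    using T(1)
  proof eventually_elim
    case (elim \<omega>)
    have "(\<lambda>n. \<sigma> * (a ^ n * Z n \<omega>) + \<mu> * a ^ n) sums
        (\<sigma> * power_sum a Z \<omega> + \<mu> * (1 / (1 - a)))"
      unfolding power_sum_def using elim a
      by (intro sums_add sums_mult summable_sums geometric_sums) auto
    moreover have "\<sigma> * (a ^ n * Z n \<omega>) + \<mu> * a ^ n = a ^ n * X n \<omega>" for n
      using \<open>\<sigma> > 0\<close> by (simp add: Z_def field_simps)
    ultimately show ?case
      by (simp add: power_sum_def sums_unique[symmetric])
  qed
  have [measurable]: "power_sum a X \<in> borel_measurable M" "power_sum a Z \<in> borel_measurable M"
    by measurable
  have std [measurable]: "standardize M (power_sum a X) \<in> borel_measurable M"
    unfolding standardize_def[abs_def] by measurable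
  define Na where "Na = distr M borel (standardize M (power_sum a X))"
  interpret Na: real_distribution Na
    unfolding Na_def by (rule real_distribution_distr) measurable
  have "AE \<omega> in M. standardize M (power_sum a X) \<omega> = power_sum a Z \<omega> / sqrt (1 / (1 - a\<^sup>2))"
    by (rule standardize_affine[OF \<open>prob_space M\<close> T(2-4) _ affine \<open>0 < \<sigma>\<close>]) measurable
  \<comment> \<open>The variance \<open>1 / (1 - a\<^sup>2)\<close> makes the normalising factor
    exactly \<open>b\<close>.\<close>
  then have "AE \<omega> in M. standardize M (power_sum a X) \<omega> = b * power_sum a Z \<omega>"
    by (simp add: b_def real_sqrt_divide mult.commute)
  then have Na_eq: "Na = distr M borel (\<lambda>\<omega>. b * power_sum a Z \<omega>)"
    unfolding Na_def by (intro distr_cong_AE) auto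
  have char_Na: "char Na x = char (distr M borel (power_sum a Z)) (b * x)" for x
    unfolding Na_eq by (simp add: char_def integral_distr ac_simps)
  \<comment> \<open>Rescaling by \<open>b\<close> commutes with rescaling by \<open>a\<close>, so
    the factorisation for the unnormalised series carries over, with the first factor evaluated at
    \<open>b * x\<close>.\<close>
  have decomp: "char Na x = char N (b * x) * char Na (a * x)" for x
    unfolding char_Na by (subst char_distr_power_sum[OF Z_indep ZN T(1)]) (simp add: ac_simps)

  \<comment> \<open>The sign convention of \<open>char_fun\<close> reflects the frequency. The
    reflection is harmless below because the Gaussian and the powers of |\<xi>| are even.\<close>
  have F: "char_fun F \<xi> = char N (- \<xi>)" for \<xi>
    using char_fun_cdf[OF N.real_distribution_axioms] assms(9) by (simp add: N_def Z_def[abs_def])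
  have Fa: "char_fun F\<^sub>a \<xi> = char Na (- \<xi>)" for \<xi>
    using char_fun_cdf[OF Na.real_distribution_axioms] assms(10) by (simp add: Na_def)
  have \<Phi>: "char_fun \<Phi> \<xi> = exp (- \<xi>\<^sup>2 / 2)" for \<xi>
    using char_fun_cdf[OF real_dist_normal_dist] assms(11) by (simp add: char_std_normal_distribution)

  let ?K = "((s - 2) * (1 - a\<^sup>2) / (exp 1 * a\<^sup>2)) powr ((s - 2) / 2)"
  \<comment> \<open>Strict positivity matters when the distance on the right is infinite: in
    \<open>ennreal\<close> a zero factor would turn the product into 0 instead of
    \<open>\<top>\<close>.\<close>
  have K: "0 < ?K"
    using \<open>2 < s\<close> a a2 by simp
  show ?thesis
  proof (cases "fourier_dist s F \<Phi> < \<top>")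
    case True
    then obtain D where D: "0 \<le> D" "fourier_dist s F \<Phi> = ennreal D"
      and bound: "\<And>\<xi>. \<xi> \<noteq> 0 \<Longrightarrow> cmod (char_fun F \<xi> - char_fun \<Phi> \<xi>) \<le> D * \<bar>\<xi>\<bar> powr s"
      by (rule fourier_dist_finite_bound) blast
    \<comment> \<open>The supremum omits frequency 0; there both characteristic functions equal 1,
      so the bound holds with left side 0.\<close>
    have close: "cmod (char N x - exp (- x\<^sup>2 / 2)) \<le> D * \<bar>x\<bar> powr s" for x
      using bound[of "- x"] by (cases "x = 0") (auto simp: F \<Phi> N.char_zero)
    have main: "cmod (char Na x - exp (- x\<^sup>2 / 2)) \<le> ?K * D * x\<^sup>2" for x
      by (rule self_decomposable_char_bound[OF a b \<open>2 < s\<close> D(1) decomp Na.isCont_char Na.char_zero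
            N.cmod_char_le_1 close])
    have "cmod (char_fun F\<^sub>a \<xi> - char_fun \<Phi> \<xi>) / \<bar>\<xi>\<bar> powr 2 \<le> ?K * D" if "\<xi> \<noteq> 0" for \<xi>
      using main[of "- \<xi>"] that by (simp add: Fa \<Phi> divide_le_eq)
    then have "fourier_dist 2 F\<^sub>a \<Phi> \<le> ennreal (?K * D)"
      unfolding fourier_dist_def by (intro SUP_least ennreal_leI) auto
    also have "\<dots> = ennreal ?K * fourier_dist s F \<Phi>"
      using D K by (simp add: ennreal_mult)
    finally show ?thesis .
  next
    case False
    then have "ennreal ?K * fourier_dist s F \<Phi> = \<top>"
      using K by (simp add: ennreal_mult_eq_top_iff less_top[symmetric])
    then show ?thesis
      by simp
  qed
qed

end
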